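(* Let $n,p$ be positive coprime integers and let $x,y\in\mathfrak D_{n,p}$ be rational Dyck paths such that $d_{i,j}(x)=d_{i,j}(y)$ for all $i,j\in[n]$ with $i<j$. Then $x=y$.
   Context: A rational Dyck path is a lattice path from $(0,0)$ with $n$ North steps $(0,1)$ and $p$ East steps $(1,0)$ never going below the line of slope $n/p$ through the origin; $\mathfrak D_{n,p}$ is the set of these. The unit square with bottom-right corner $(i,j)$ gets label $\ell_{i,j}=jp-in$; each step of a path gets the label of its starting point $(i,j)$. Let $\ell_1<\dots<\ell_n$ be the labels of the North steps of $x$, and $H(x)$ the set of positive labels of unit squares lying below $x$ (between $x$ and the diagonal). The codinv tableau of $x$ is $d_{i,j}(x)=\#\{h\in H(x):\ell_i<h<\ell_i+p,\ h\equiv\ell_j\pmod n\}$ for $i<j$ in $[n]$. *)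

theory Defs
  imports "HOL-Number_Theory.Cong"
begin

datatype step = North | East

text \<open>A path starting at the origin is its list of steps; \<open>pos x k\<close> is the starting point
  \<open>(i, j)\<close> of the step \<open>x ! k\<close> (horizontal coordinate first).\<close>

definition pos :: "step list \<Rightarrow> nat \<Rightarrow> nat \<times> nat" where
  "pos x k = (count_list (take k x) East, count_list (take k x) North)"

definition lab :: "nat \<Rightarrow> nat \<Rightarrow> nat \<times> nat \<Rightarrow> int" where
  "lab n p = (\<lambda>(i, j). int j * int p - int i * int n)"

text \<open>A point \<open>(i, j)\<close> is not below the line of slope \<open>n / p\<close> through the origin iff
  \<open>i * n \<le> j * p\<close>. Since steps are axis-parallel unit segments, it suffices to test the
  lattice points of the path.\<close>

definition rational_dyck_paths :: "nat \<Rightarrow> nat \<Rightarrow> step list set" where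
  "rational_dyck_paths n p =
    {x. count_list x North = n \<and> count_list x East = p \<and>
        (\<forall>k\<le>length x. fst (pos x k) * n \<le> snd (pos x k) * p)}"

definition north_labels :: "nat \<Rightarrow> nat \<Rightarrow> step list \<Rightarrow> int set" where
  "north_labels n p x = {lab n p (pos x k) |k. k < length x \<and> x ! k = North}"

text \<open>The \<open>i\<close>-th smallest North label, indexed from 1. For coprime \<open>n\<close>, \<open>p\<close> the labels of the
  \<open>n\<close> North steps of a path in \<open>rational_dyck_paths n p\<close> are pairwise distinct.\<close>

definition north_label :: "nat \<Rightarrow> nat \<Rightarrow> step list \<Rightarrow> nat \<Rightarrow> int" where
  "north_label n p x i = sorted_list_of_set (north_labels n p x) ! (i - 1)"

text \<open>Unit squares are named by their bottom-right corner: \<open>(i, j)\<close> stands for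
  \<open>[i - 1, i] \<times> [j, j + 1]\<close>. It lies below the path iff the East step of the path in that
  column, from \<open>(i - 1, h)\<close> to \<open>(i, h)\<close>, has \<open>h \<ge> j + 1\<close>.\<close>

definition squares_below :: "step list \<Rightarrow> (nat \<times> nat) set" where
  "squares_below x =
    {(i, j). \<exists>k<length x. x ! k = East \<and> i = fst (pos x k) + 1 \<and> j + 1 \<le> snd (pos x k)}"

text \<open>The label of a square is positive iff its bottom-right corner, hence the whole square, lies
  strictly above the diagonal.\<close>

definition H :: "nat \<Rightarrow> nat \<Rightarrow> step list \<Rightarrow> int set" where
  "H n p x = {h \<in> lab n p ` squares_below x. h > 0}"

definition codinv :: "nat \<Rightarrow> nat \<Rightarrow> step list \<Rightarrow> nat \<Rightarrow> nat \<Rightarrow> nat" where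
  "codinv n p x i j =
    card {h \<in> H n p x. north_label n p x i < h \<and> h < north_label n p x i + int p \<and>
                       [h = north_label n p x j] (mod int n)}"

end

theory Submission
  imports Defs
begin

text \<open>A Dyck path visits \<open>n + p\<close> distinct labels, and the order of the labels only matters through
  ranks. Summing the codinv tableau along rows and columns and telescoping around the path (which
  returns to label 0) shows that the \<open>j\<close>-th column sum is the number of East steps starting below
  \<open>\<ell>\<^sub>j\<close>, and that the \<open>i\<close>-th row sum is the number of East steps ending at or above
  \<open>\<ell>\<^sub>i + p\<close>. The former tells how North and East starting points interleave, the latter how
  North and East end points do. As the \<open>i\<close>-th lowest North (East) starting point leads to the
  \<open>i\<close>-th lowest North (East) end point, this determines the permutation of ranks that sends each
  point of the path to the next one; following it from rank 0 recovers the path.\<close>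

section \<open>Lattice positions along a list of steps\<close>

lemma length_eq_count_North_East: "length x = count_list x North + count_list x East"
proof (induction x)
  case (Cons s x)
  then show ?case by (cases s) auto
qed simp

lemma card_nth_eq_count_list: "card {k. k < length x \<and> x ! k = s} = count_list x s"
proof -
  have "count_list x s = length (filter (\<lambda>t. t = s) x)"
    by (induction x) auto
  then show ?thesis
    by (simp add: length_filter_conv_card)
qed

lemma pos_0: "pos x 0 = (0, 0)"
  by (simp add: pos_def)

lemma pos_Suc:
  assumes "k < length x"
  shows "pos x (Suc k) = (if x ! k = North then (fst (pos x k), Suc (snd (pos x k)))
                          else (Suc (fst (pos x k)), snd (pos x k)))"
  using assms by (cases "x ! k") (auto simp: pos_def take_Suc_conv_app_nth)

lemma pos_mono:
  assumes "k \<le> l"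
  shows "fst (pos x k) \<le> fst (pos x l)" "snd (pos x k) \<le> snd (pos x l)"
proof -
  have "take l x = take k x @ take (l - k) (drop k x)"
    using assms by (metis le_add_diff_inverse take_add)
  then show "fst (pos x k) \<le> fst (pos x l)" "snd (pos x k) \<le> snd (pos x l)"
    by (auto simp: pos_def)
qed

lemma fst_pos_less:
  assumes "k < l" "k < length x" "x ! k = East"
  shows "fst (pos x k) < fst (pos x l)"
  using pos_mono(1)[of "Suc k" l x] pos_Suc[of k x] assms by auto

lemma snd_pos_less:
  assumes "k < l" "k < length x" "x ! k = North"
  shows "snd (pos x k) < snd (pos x l)"
  using pos_mono(2)[of "Suc k" l x] pos_Suc[of k x] assms by auto

lemma fst_snd_pos:
  assumes "k \<le> length x"
  shows "fst (pos x k) + snd (pos x k) = k"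
  using length_eq_count_North_East[of "take k x"] assms by (simp add: pos_def)

section \<open>Counting multiples with floor division\<close>

text \<open>For positive \<open>n\<close> this is the number of positive multiples of
  \<open>n\<close> that do not exceed \<open>u\<close>.\<close>

definition pos_div :: "int \<Rightarrow> int \<Rightarrow> int" where
  "pos_div n u = max 0 (u div n)"

lemma pos_div_nonpos: "n > 0 \<Longrightarrow> u \<le> 0 \<Longrightarrow> pos_div n u = 0"
  unfolding pos_div_def
  by (metis div_by_0 div_nonpos_pos_le0 max.absorb1)

text \<open>An East step lowers the label by \<open>n\<close>; this makes its contribution to a
  telescoped sum a 0-1 indicator.\<close>

lemma pos_div_step:
  assumes "n > 0"
  shows "pos_div n u - pos_div n (u - n) = (if u \<ge> n then 1 else 0)"
proof -
  have 1: "(u - n) div n = u div n - 1"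
    using assms by (metis div_add_self2 diff_add_cancel add_diff_cancel_right' less_irrefl)
  have 2: "u div n \<ge> 1 \<longleftrightarrow> u \<ge> n"
    using assms by (metis div_self less_irrefl pos_imp_zdiv_pos_iff zdiv_mono1 zless_imp_add1_zle
        add_0 zero_less_one less_le_trans)
  show ?thesis
    using 1 2 by (auto simp: pos_div_def)
qed

text \<open>Membership in the window means \<open>k * n \<le> c - a\<close> but not
  \<open>k * n \<le> c - a - p\<close>, so the count is a difference of two counts of positive
  multiples.\<close>

lemma card_progression_window:
  fixes n p a c :: int
  assumes "n > 0" "p > 0"
  shows "int (card {h. \<exists>k\<ge>1. h = c - k * n \<and> a \<le> h \<and> h < a + p})
           = pos_div n (c - a) - pos_div n (c - a - p)"
proof -
  have le: "k * n \<le> u \<longleftrightarrow> k \<le> u div n" for k u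
  proof
    assume "k * n \<le> u"
    then have "(k * n) div n \<le> u div n"
      using assms(1) by (rule zdiv_mono1)
    then show "k \<le> u div n" using assms(1) by simp
  next
    assume "k \<le> u div n"
    then have "k * n \<le> u div n * n"
      using assms(1) by simp
    also have "\<dots> \<le> u"
      using assms(1) pos_mod_sign[of n u] minus_mod_eq_div_mult[of u n] by linarith
    finally show "k * n \<le> u" .
  qed
  have "{h. \<exists>k\<ge>1. h = c - k * n \<and> a \<le> h \<and> h < a + p}
          = (\<lambda>k. c - k * n) ` {k. 1 \<le> k \<and> k * n \<le> c - a \<and> \<not> k * n \<le> c - a - p}"
    by (auto simp: algebra_simps image_iff)
  also have "{k. 1 \<le> k \<and> k * n \<le> c - a \<and> \<not> k * n \<le> c - a - p}
          = {pos_div n (c - a - p)<..pos_div n (c - a)}"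
    unfolding le by (auto simp: pos_div_def)
  finally have "card {h. \<exists>k\<ge>1. h = c - k * n \<and> a \<le> h \<and> h < a + p}
      = card ((\<lambda>k. c - k * n) ` {pos_div n (c - a - p)<..pos_div n (c - a)})"
    by simp
  also have "\<dots> = card {pos_div n (c - a - p)<..pos_div n (c - a)}"
    using assms(1) by (intro card_image) (auto simp: inj_on_def)
  finally show ?thesis
    using zdiv_mono1[of "c - a - p" "c - a" n] assms by (auto simp: pos_div_def)
qed

section \<open>Labels along one rational Dyck path\<close>

locale rational_dyck_path =
  fixes n p :: nat and x :: "step list"
  assumes n_pos: "n > 0" and p_pos: "p > 0" and coprime: "coprime n p"
    and dyck: "x \<in> rational_dyck_paths n p"
begin

text \<open>Also used at \<open>k = length x\<close>, the end point of the path, whose label is 0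
  again.\<close>

abbreviation w :: "nat \<Rightarrow> int" where
  "w k \<equiv> lab n p (pos x k)"

abbreviation norths :: "nat set" where
  "norths \<equiv> {k. k < length x \<and> x ! k = North}"

abbreviation easts :: "nat set" where
  "easts \<equiv> {k. k < length x \<and> x ! k = East}"

abbreviation l :: "nat \<Rightarrow> int" where
  "l \<equiv> north_label n p x"

lemma length_path: "length x = n + p"
  using dyck length_eq_count_North_East[of x] by (simp add: rational_dyck_paths_def)

lemma card_norths: "card norths = n" and card_easts: "card easts = p"
  using dyck by (simp_all add: card_nth_eq_count_list rational_dyck_paths_def)

lemma pos_length: "pos x (length x) = (p, n)"
  using dyck by (simp add: rational_dyck_paths_def pos_def)

lemma indices_split: "{..<length x} = norths \<union> easts" "norths \<inter> easts = {}"
  by (auto intro: step.exhaust)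

lemma w_eq: "w k = int (snd (pos x k)) * int p - int (fst (pos x k)) * int n"
  by (simp add: lab_def case_prod_beta)

lemma w_0: "w 0 = 0"
  by (simp add: lab_def pos_0)

lemma w_length: "w (length x) = 0"
  by (simp add: lab_def pos_length)

lemma w_nonneg: "k \<le> length x \<Longrightarrow> w k \<ge> 0"
  using dyck unfolding rational_dyck_paths_def w_eq
  by (auto simp flip: of_nat_mult)

lemma w_Suc_north: "k \<in> norths \<Longrightarrow> w (Suc k) = w k + int p"
  by (simp add: lab_def case_prod_beta pos_Suc algebra_simps)

lemma w_Suc_east: "k \<in> easts \<Longrightarrow> w (Suc k) = w k - int n"
  by (simp add: lab_def case_prod_beta pos_Suc algebra_simps)

text \<open>Equal labels with \<open>i\<close> East and \<open>j\<close> North steps in between give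
  \<open>j * p = i * n\<close>. By coprimality \<open>n\<close> divides \<open>j\<close> and
  \<open>p\<close> divides \<open>i\<close>, which requires at least \<open>n + p\<close> steps, the
  whole path.\<close>

lemma inj_w: "inj_on w {..<length x}"
proof (rule linorder_inj_onI)
  fix k m
  assume km: "k < m" and "k \<in> {..<length x}" "m \<in> {..<length x}"
  then have lt: "k < length x" "m < length x" by auto
  obtain i j where ij: "fst (pos x m) = fst (pos x k) + i" "snd (pos x m) = snd (pos x k) + j"
    using pos_mono[of k m x] km by (metis less_imp_le le_Suc_ex)
  have ij_sum: "i + j = m - k"
    using fst_snd_pos[of k x] fst_snd_pos[of m x] lt ij by linarith
  show "w k \<noteq> w m"
  proof
    assume "w k = w m"
    then have "int (j * p) = int (i * n)"
      unfolding w_eq ij by (simp add: algebra_simps)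
    then have eq: "j * p = i * n" by (simp only: of_nat_eq_iff)
    have "n dvd j"
      using coprime eq by (metis coprime_dvd_mult_left_iff dvd_triv_right)
    moreover have "p dvd i"
      using coprime eq by (metis coprime_commute coprime_dvd_mult_left_iff dvd_triv_right)
    \<comment> \<open>If one of them vanished, so would the other, but \<open>i + j = m - k\<close>
      is positive.\<close>
    moreover have "i > 0 \<and> j > 0"
      using eq ij_sum km n_pos p_pos by (cases "i = 0"; cases "j = 0") auto
    ultimately have "n + p \<le> j + i"
      by (intro add_mono dvd_imp_le) auto
    then show False
      using ij_sum lt length_path by linarith
  qed
qed auto

lemma w_eq_iff: "k < length x \<Longrightarrow> m < length x \<Longrightarrow> w k = w m \<longleftrightarrow> k = m"
  using inj_w by (auto dest: inj_onD)

lemma north_labels_eq: "north_labels n p x = w ` norths"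
  by (auto simp: north_labels_def)

lemma card_north_labels: "card (north_labels n p x) = n"
proof -
  have "inj_on w norths"
    using inj_w by (rule inj_on_subset) auto
  then show ?thesis
    by (simp add: north_labels_eq card_image card_norths)
qed

lemma finite_north_labels: "finite (north_labels n p x)"
  by (simp add: north_labels_eq)

lemma l_less: "i \<in> {1..n} \<Longrightarrow> j \<in> {1..n} \<Longrightarrow> i < j \<Longrightarrow> l i < l j"
  unfolding north_label_def
  using strict_sorted_list_of_set[of "north_labels n p x"] card_north_labels
  by (intro sorted_wrt_nth_less[where P = "(<)"]) auto

lemma l_less_iff: "i \<in> {1..n} \<Longrightarrow> j \<in> {1..n} \<Longrightarrow> l i < l j \<longleftrightarrow> i < j"
  using l_less[of i j] l_less[of j i] by (metis linorder_cases less_asym less_irrefl)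

lemma bij_l: "bij_betw l {1..n} (w ` norths)"
proof (rule bij_betw_imageI)
  show "inj_on l {1..n}"
    by (rule linorder_inj_onI) (use l_less in force)+
  let ?xs = "sorted_list_of_set (north_labels n p x)"
  have "l ` {1..n} = (\<lambda>i. ?xs ! i) ` {..<n}"
  proof -
    have "{1..n} = Suc ` {..<n}" by (simp add: image_Suc_lessThan)
    then show ?thesis by (simp add: north_label_def image_image)
  qed
  also have "\<dots> = set ?xs"
    using card_north_labels by (auto simp: set_conv_nth)
  finally show "l ` {1..n} = w ` norths"
    by (simp add: finite_north_labels north_labels_eq)
qed

lemma bij_w_norths: "bij_betw w norths (w ` norths)"
  using inj_w by (intro bij_betw_imageI) (auto intro: inj_on_subset)

text \<open>Passes from the sorted labels that index the tableau to the order of traversal, in which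
  sums telescope.\<close>

lemma sum_l: "(\<Sum>i\<in>{1..n}. f (l i)) = (\<Sum>k\<in>norths. f (w k))"
  using sum.reindex_bij_betw[OF bij_l, of f] sum.reindex_bij_betw[OF bij_w_norths, of f] by simp

lemma l_obtain:
  assumes "i \<in> {1..n}"
  obtains k where "k \<in> norths" "l i = w k"
  using bij_betwE[OF bij_l] assms by blast

lemma north_obtain:
  assumes "k \<in> norths"
  obtains i where "i \<in> {1..n}" "w k = l i"
  using bij_l assms unfolding bij_betw_def by blast

section \<open>Rows, columns and the labels below the path\<close>

text \<open>Heights strictly increase from one North step to the next, so the \<open>n\<close> North
  steps fill the \<open>n\<close> rows.\<close>

lemma surj_heights: "(\<lambda>k. snd (pos x k)) ` norths = {..<n}"
proof (rule card_subset_eq)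
  show "(\<lambda>k. snd (pos x k)) ` norths \<subseteq> {..<n}"
    using snd_pos_less[of _ "length x" x] pos_length by auto
  have "inj_on (\<lambda>k. snd (pos x k)) norths"
    by (rule linorder_inj_onI) (use snd_pos_less[of _ _ x] in force)+
  then show "card ((\<lambda>k. snd (pos x k)) ` norths) = card {..<n}"
    by (simp add: card_image card_norths)
qed simp

lemma surj_widths: "(\<lambda>k. fst (pos x k)) ` easts = {..<p}"
proof (rule card_subset_eq)
  show "(\<lambda>k. fst (pos x k)) ` easts \<subseteq> {..<p}"
    using fst_pos_less[of _ "length x" x] pos_length by auto
  have "inj_on (\<lambda>k. fst (pos x k)) easts"
    by (rule linorder_inj_onI) (use fst_pos_less[of _ _ x] in force)+
  then show "card ((\<lambda>k. fst (pos x k)) ` easts) = card {..<p}"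
    by (simp add: card_image card_easts)
qed simp

text \<open>Modulo \<open>n\<close> a label is its height times \<open>p\<close>. As
  \<open>p\<close> is invertible modulo \<open>n\<close>, the residue fixes the height, and hence
  the North step.\<close>

lemma norths_cong_imp_eq:
  assumes "k \<in> norths" "m \<in> norths" "[w k = w m] (mod int n)"
  shows "k = m"
proof -
  have ht: "snd (pos x k) < n" "snd (pos x m) < n"
    using surj_heights assms by blast+
  have "[int (snd (pos x k)) * int p = int (snd (pos x m)) * int p] (mod int n)"
  proof -
    have "int n dvd w k - w m"
      using assms(3) by (simp add: cong_iff_dvd_diff)
    then have "int n dvd w k - w m + int n * (int (fst (pos x k)) - int (fst (pos x m)))"
      by simp
    then show ?thesis
      by (simp add: cong_iff_dvd_diff w_eq algebra_simps)
  qed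
  then have "[snd (pos x k) * p = snd (pos x m) * p] (mod n)"
    by (simp flip: of_nat_mult add: cong_int_iff)
  then have "[snd (pos x k) = snd (pos x m)] (mod n)"
    using coprime by (simp add: cong_mult_rcancel_nat coprime_commute)
  then have "snd (pos x k) = snd (pos x m)"
    using ht by (simp add: cong_def)
  then show ?thesis
    using assms snd_pos_less[of k m x] snd_pos_less[of m k x] by (cases k m rule: linorder_cases) auto
qed

text \<open>Each row contains one North step, and labels drop by \<open>n\<close> per square to its
  right. Positivity alone stops the row: squares above the diagonal and to the right of that step
  lie below the path.\<close>

lemma H_eq: "H n p x = {h. h > 0 \<and> (\<exists>m\<in>norths. \<exists>k\<ge>1. h = w m - k * int n)}"
proof (intro set_eqI iffI)
  fix h
  assume "h \<in> H n p x"
  then obtain i j k where h: "h > 0" "h = lab n p (i, j)"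
    and k: "k < length x" "x ! k = East" "i = fst (pos x k) + 1" "j + 1 \<le> snd (pos x k)"
    by (auto simp: H_def squares_below_def)
  have "j < n"
    using k pos_mono(2)[of k "length x" x] pos_length by auto
  then obtain m where m: "m \<in> norths" "snd (pos x m) = j"
    using surj_heights by (metis (no_types, lifting) imageE lessThan_iff)
  have "m < k"
    using m k pos_mono(2)[of k m x] by (metis Suc_eq_plus1 not_less not_less_eq_eq order_trans)
  then have "fst (pos x m) \<le> fst (pos x k)"
    by (simp add: pos_mono)
  then have "int i - int (fst (pos x m)) \<ge> 1"
    using k by simp
  moreover have "h = w m - (int i - int (fst (pos x m))) * int n"
    using h m by (simp add: lab_def case_prod_beta algebra_simps)
  ultimately show "h \<in> {h. h > 0 \<and> (\<exists>m\<in>norths. \<exists>k\<ge>1. h = w m - k * int n)}"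
    using h m by blast
next
  fix h
  assume "h \<in> {h. h > 0 \<and> (\<exists>m\<in>norths. \<exists>k\<ge>1. h = w m - k * int n)}"
  then obtain m k' where h: "h > 0" "m \<in> norths" "k' \<ge> 1" "h = w m - k' * int n"
    by blast
  \<comment> \<open>The square \<open>k'\<close> columns to the right of North step
    \<open>m\<close>, named by its bottom-right corner.\<close>
  define i where "i = fst (pos x m) + nat k'"
  define j where "j = snd (pos x m)"
  have hij: "h = lab n p (i, j)"
    using h by (simp add: i_def j_def lab_def case_prod_beta algebra_simps)
  have "j < n"
    using surj_heights h j_def by blast
  \<comment> \<open>Positivity of the label bounds the column, so that some East step of the path
    crosses it.\<close>
  have "int (i * n) < int (j * p)"
    using h hij by (simp add: lab_def)
  then have "i * n < j * p" by (simp only: of_nat_less_iff)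
  also have "\<dots> \<le> n * p" using \<open>j < n\<close> by simp
  finally have "i < p" by (simp add: mult.commute)
  then have "i - 1 < p" by simp
  then obtain k where k: "k \<in> easts" "fst (pos x k) = i - 1"
    using surj_widths by (metis (no_types, lifting) imageE lessThan_iff)
  have "i \<ge> 1" "fst (pos x m) < i" using h by (auto simp: i_def)
  have "m < k"
  proof (rule ccontr)
    assume "\<not> m < k"
    moreover have "m \<noteq> k" using h k by auto
    ultimately have "fst (pos x k) < fst (pos x m)"
      using k by (intro fst_pos_less) auto
    then show False using k \<open>fst (pos x m) < i\<close> by linarith
  qed
  then have "j < snd (pos x k)"
    unfolding j_def using h by (intro snd_pos_less) auto
  then have "(i, j) \<in> squares_below x"
    using k \<open>i \<ge> 1\<close> by (auto simp: squares_below_def)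
  then show "h \<in> H n p x"
    using h(1) unfolding hij by (simp add: H_def)
qed

text \<open>The residue condition selects the row of the North step labelled \<open>l j\<close>,
  where the labels form an arithmetic progression; the entry counts its terms in a window.\<close>

lemma codinv_eq:
  assumes "i \<in> {1..n}" "j \<in> {1..n}" "i < j"
  shows "int (codinv n p x i j) = pos_div (int n) (l j - l i) - pos_div (int n) (l j - l i - int p)"
proof -
  obtain k where k: "k \<in> norths" "l i = w k" using assms l_obtain by blast
  obtain m where m: "m \<in> norths" "l j = w m" using assms l_obtain by blast
  have km: "k \<noteq> m" using l_less[OF assms] k m by auto
  have "{h \<in> H n p x. l i < h \<and> h < l i + int p \<and> [h = l j] (mod int n)}
          = {h. \<exists>q\<ge>1. h = l j - q * int n \<and> l i \<le> h \<and> h < l i + int p}"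
  proof (intro set_eqI iffI)
    fix h
    assume "h \<in> {h \<in> H n p x. l i < h \<and> h < l i + int p \<and> [h = l j] (mod int n)}"
    then obtain m' q where h: "l i < h" "h < l i + int p" "[h = l j] (mod int n)"
      "m' \<in> norths" "q \<ge> 1" "h = w m' - q * int n"
      by (auto simp: H_eq)
    have "[w m' = h] (mod int n)"
      using h by (simp add: cong_iff_dvd_diff)
    then have "[w m' = w m] (mod int n)"
      using h m cong_trans by metis
    then have "m' = m" using norths_cong_imp_eq h m by blast
    then show "h \<in> {h. \<exists>q\<ge>1. h = l j - q * int n \<and> l i \<le> h \<and> h < l i + int p}"
      using h m by auto
  next
    fix h
    assume "h \<in> {h. \<exists>q\<ge>1. h = l j - q * int n \<and> l i \<le> h \<and> h < l i + int p}"
    then obtain q where h: "q \<ge> 1" "h = l j - q * int n" "l i \<le> h" "h < l i + int p" by blast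
    have c: "[h = l j] (mod int n)"
      using h by (simp add: cong_iff_dvd_diff)
    \<comment> \<open>Distinct North labels are incongruent, so the strict lower bound of
      \<open>codinv\<close> may be replaced by a weak one.\<close>
    then have "h \<noteq> l i"
      using km k m norths_cong_imp_eq by auto
    then have "l i < h" using h by simp
    moreover have "h > 0"
      using \<open>l i < h\<close> k w_nonneg[of k] by auto
    ultimately show "h \<in> {h \<in> H n p x. l i < h \<and> h < l i + int p \<and> [h = l j] (mod int n)}"
      using h c m by (auto simp: H_eq)
  qed
  then show ?thesis
    using card_progression_window[of "int n" "int p" "l j" "l i"] n_pos p_pos
    by (simp add: codinv_def)
qed

section \<open>Row and column sums by telescoping\<close>

text \<open>The path starts and ends at label 0, so the increments of any \<open>f\<close> along it
  add up to 0. It is applied to shifts of \<open>pos_div\<close> and to threshold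
  indicators.\<close>

lemma closed_path_sum:
  fixes f :: "int \<Rightarrow> int"
  shows "(\<Sum>k\<in>norths. f (w k + int p) - f (w k)) = (\<Sum>k\<in>easts. f (w k) - f (w k - int n))"
proof -
  have "0 = (\<Sum>k<length x. f (w (Suc k)) - f (w k))"
    using sum_lessThan_telescope[of "\<lambda>k. f (w k)" "length x"] by (simp add: w_0 w_length)
  also have "\<dots> = (\<Sum>k\<in>norths. f (w (Suc k)) - f (w k)) + (\<Sum>k\<in>easts. f (w (Suc k)) - f (w k))"
    unfolding indices_split(1) using indices_split(2) by (intro sum.union_disjoint) auto
  also have "(\<Sum>k\<in>norths. f (w (Suc k)) - f (w k)) = (\<Sum>k\<in>norths. f (w k + int p) - f (w k))"
    using w_Suc_north by (intro sum.cong) auto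
  also have "(\<Sum>k\<in>easts. f (w (Suc k)) - f (w k)) = (\<Sum>k\<in>easts. - (f (w k) - f (w k - int n)))"
    using w_Suc_east by (intro sum.cong) auto
  finally show ?thesis
    unfolding sum_negf by linarith
qed

lemma row_sum:
  assumes "i \<in> {1..n}"
  shows "(\<Sum>j\<in>{i<..n}. codinv n p x i j) = card {k \<in> easts. l i + int p \<le> w k - int n}"
proof -
  let ?d = "\<lambda>t. pos_div (int n) (t - l i) - pos_div (int n) (t - l i - int p)"
  have "int (\<Sum>j\<in>{i<..n}. codinv n p x i j) = (\<Sum>j\<in>{i<..n}. ?d (l j))"
    using assms codinv_eq[of i] by (auto intro!: sum.cong)
  also have "\<dots> = (\<Sum>j\<in>{1..n}. ?d (l j))"
  proof (rule sum.mono_neutral_left)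
    \<comment> \<open>For \<open>j \<le> i\<close> both arguments of \<open>pos_div\<close> are
      nonpositive, so the sum extends to all North steps.\<close>
    show "\<forall>j\<in>{1..n} - {i<..n}. ?d (l j) = 0"
    proof
      fix j assume j: "j \<in> {1..n} - {i<..n}"
      then have "l j \<le> l i" using assms l_less_iff[of i j] by auto
      then show "?d (l j) = 0" using n_pos by (simp add: pos_div_nonpos)
    qed
  qed (use assms in auto)
  also have "\<dots> = (\<Sum>k\<in>norths. ?d (w k))" by (rule sum_l)
  \<comment> \<open>Rewritten as increments of \<open>f t = pos_div n (t - (l i + p))\<close> along
    North steps.\<close>
  also have "\<dots> = (\<Sum>k\<in>norths. pos_div (int n) (w k + int p - (l i + int p)) - pos_div (int n) (w k - (l i + int p)))"
    by (simp add: algebra_simps)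
  also have "\<dots> = (\<Sum>k\<in>easts. pos_div (int n) (w k - (l i + int p)) - pos_div (int n) (w k - int n - (l i + int p)))"
    by (rule closed_path_sum)
  also have "\<dots> = (\<Sum>k\<in>easts. if l i + int p \<le> w k - int n then 1 else 0)"
  proof (rule sum.cong)
    fix k
    show "pos_div (int n) (w k - (l i + int p)) - pos_div (int n) (w k - int n - (l i + int p))
            = (if l i + int p \<le> w k - int n then 1 else 0)"
      using pos_div_step[of "int n" "w k - (l i + int p)"] n_pos by (auto simp: algebra_simps)
  qed simp
  also have "\<dots> = int (card {k \<in> easts. l i + int p \<le> w k - int n})"
    by (simp add: sum.If_cases Int_def)
  finally show ?thesis by (simp only: of_nat_eq_iff)
qed

lemma column_sum:
  assumes "j \<in> {1..n}"
  shows "(\<Sum>i\<in>{1..<j}. codinv n p x i j) = card {k \<in> easts. w k < l j}"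
proof -
  let ?d = "\<lambda>t. pos_div (int n) (l j - t) - pos_div (int n) (l j - t - int p)"
  obtain m where m: "m \<in> norths" "l j = w m" using assms l_obtain by blast
  have "int (\<Sum>i\<in>{1..<j}. codinv n p x i j) = (\<Sum>i\<in>{1..<j}. ?d (l i))"
    using assms codinv_eq[of _ j] by (auto intro!: sum.cong)
  also have "\<dots> = (\<Sum>i\<in>{1..n}. ?d (l i))"
  proof (rule sum.mono_neutral_left)
    show "\<forall>i\<in>{1..n} - {1..<j}. ?d (l i) = 0"
    proof
      fix i assume i: "i \<in> {1..n} - {1..<j}"
      then have "l j \<le> l i" using assms l_less_iff[of i j] by auto
      then show "?d (l i) = 0" using n_pos by (simp add: pos_div_nonpos)
    qed
  qed (use assms in auto)
  also have "\<dots> = (\<Sum>k\<in>norths. ?d (w k))" by (rule sum_l)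
  \<comment> \<open>Here \<open>f t = pos_div n (l j - t)\<close>; it reverses the order of labels,
    hence the sign.\<close>
  also have "\<dots> = - (\<Sum>k\<in>norths. pos_div (int n) (l j - (w k + int p)) - pos_div (int n) (l j - w k))"
    by (simp add: algebra_simps flip: sum_negf)
  also have "\<dots> = - (\<Sum>k\<in>easts. pos_div (int n) (l j - w k) - pos_div (int n) (l j - (w k - int n)))"
    by (subst closed_path_sum) simp
  also have "\<dots> = (\<Sum>k\<in>easts. if w k < l j then 1 else 0)"
    unfolding sum_negf[symmetric]
  proof (rule sum.cong)
    fix k assume "k \<in> easts"
    \<comment> \<open>\<open>pos_div_step\<close> yields \<open>w k \<le> l j\<close>; East and
      North starting labels differ, which makes it strict.\<close>
    then have "w k \<noteq> l j" using m w_eq_iff by auto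
    then show "- (pos_div (int n) (l j - w k) - pos_div (int n) (l j - (w k - int n))) = (if w k < l j then 1 else 0)"
      using pos_div_step[of "int n" "l j - (w k - int n)"] n_pos by (auto simp: algebra_simps)
  qed simp
  also have "\<dots> = int (card {k \<in> easts. w k < l j})"
    by (simp add: sum.If_cases Int_def)
  finally show ?thesis by (simp only: of_nat_eq_iff)
qed

section \<open>Ranks of starting points and end points\<close>

definition rank :: "nat \<Rightarrow> nat" where
  "rank k = card {m. m < length x \<and> w m < w k}"

text \<open>By \<open>column_sum\<close> this is the \<open>i\<close>-th column sum of the tableau,
  hence shared by \<open>x\<close> and \<open>y\<close>.\<close>

definition easts_before :: "nat \<Rightarrow> nat" where
  "easts_before i = card {k \<in> easts. w k < l i}"

text \<open>The same count for end points; by \<open>row_sum\<close> it is \<open>p\<close> minus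
  the \<open>i\<close>-th row sum.\<close>

definition east_ends_before :: "nat \<Rightarrow> nat" where
  "east_ends_before i = card {k \<in> easts. w k - int n < l i + int p}"

lemma east_ends_before_row_sum:
  assumes "i \<in> {1..n}"
  shows "east_ends_before i = p - (\<Sum>j\<in>{i<..n}. codinv n p x i j)"
proof -
  have "{k \<in> easts. w k - int n < l i + int p} = easts - {k \<in> easts. l i + int p \<le> w k - int n}"
    by auto
  moreover have "card (easts - {k \<in> easts. l i + int p \<le> w k - int n})
      = card easts - card {k \<in> easts. l i + int p \<le> w k - int n}"
    by (rule card_Diff_subset) auto
  ultimately show ?thesis
    using row_sum[OF assms] by (simp add: east_ends_before_def card_easts)
qed

lemma card_norths_eq_card_indices:
  "card {k \<in> norths. P (w k)} = card {i \<in> {1..n}. P (l i)}"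
proof -
  have "card {k \<in> norths. P (w k)} = (\<Sum>k\<in>norths. if P (w k) then 1 else 0)"
    by (simp add: sum.If_cases Int_def)
  also have "\<dots> = (\<Sum>i\<in>{1..n}. if P (l i) then 1 else 0)"
    by (rule sum_l[symmetric])
  also have "\<dots> = card {i \<in> {1..n}. P (l i)}"
    by (simp add: sum.If_cases Int_def)
  finally show ?thesis .
qed

lemma card_indices_less:
  assumes "i \<in> {1..n}"
  shows "card {j \<in> {1..n}. l j < l i} = i - 1"
proof -
  have "{j \<in> {1..n}. l j < l i} = {1..<i}"
    using assms l_less_iff[of _ i] by auto
  then show ?thesis by simp
qed

lemma rank_split:
  "rank k = card {i \<in> {1..n}. l i < w k} + card {m \<in> easts. w m < w k}"
proof -
  have "{m. m < length x \<and> w m < w k} = {m \<in> norths. w m < w k} \<union> {m \<in> easts. w m < w k}"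
    using indices_split(1) by auto
  moreover have "card ({m \<in> norths. w m < w k} \<union> {m \<in> easts. w m < w k})
      = card {m \<in> norths. w m < w k} + card {m \<in> easts. w m < w k}"
    by (rule card_Un_disjoint) auto
  ultimately show ?thesis
    unfolding rank_def card_norths_eq_card_indices[of "\<lambda>t. t < w k", symmetric] by simp
qed

text \<open>The set of labels of starting points is also the set of labels of end points.\<close>

lemma rank_split_ends:
  "rank k = card {i \<in> {1..n}. l i + int p < w k} + card {m \<in> easts. w m - int n < w k}"
proof -
  let ?f = "\<lambda>t. if t < w k then 1 else 0 :: int"
  have "(\<Sum>m\<in>norths. ?f (w m + int p) - ?f (w m)) = (\<Sum>m\<in>easts. ?f (w m) - ?f (w m - int n))"
    by (rule closed_path_sum)
  then have "(\<Sum>m\<in>norths. ?f (w m + int p)) + (\<Sum>m\<in>easts. ?f (w m - int n))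
      = (\<Sum>m\<in>norths. ?f (w m)) + (\<Sum>m\<in>easts. ?f (w m))"
    by (simp add: sum_subtractf)
  moreover have "(\<Sum>m\<in>norths. ?f (w m + int p)) = (\<Sum>i\<in>{1..n}. ?f (l i + int p))"
    by (rule sum_l[symmetric])
  moreover have "(\<Sum>m\<in>norths. ?f (w m)) = (\<Sum>i\<in>{1..n}. ?f (l i))"
    by (rule sum_l[symmetric])
  ultimately have "int (card {i \<in> {1..n}. l i + int p < w k} + card {m \<in> easts. w m - int n < w k})
      = int (card {i \<in> {1..n}. l i < w k} + card {m \<in> easts. w m < w k})"
    by (simp add: sum.If_cases Int_def)
  then show ?thesis
    using rank_split by (simp only: of_nat_eq_iff)
qed

lemma rank_less_iff:
  assumes "k < length x" "m < length x"
  shows "rank k < rank m \<longleftrightarrow> w k < w m"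
proof -
  have *: "rank k < rank m" if "w k < w m" "k < length x" for k m
    unfolding rank_def using that by (intro psubset_card_mono) auto
  show ?thesis
    using *[of k m] *[of m k] w_eq_iff[OF assms] assms
    by (metis linorder_neqE less_asym less_irrefl)
qed

lemma rank_eq_iff:
  assumes "k < length x" "m < length x"
  shows "rank k = rank m \<longleftrightarrow> k = m"
  using rank_less_iff[OF assms] rank_less_iff[of m k] w_eq_iff[OF assms] assms
  by (metis linorder_neqE less_irrefl)

lemma rank_label:
  assumes "i \<in> {1..n}" "w k = l i"
  shows "rank k = i - 1 + easts_before i"
  using rank_split[of k] card_indices_less[OF assms(1)] assms by (simp add: easts_before_def)

text \<open>Reads the type of a step off its rank and \<open>easts_before\<close> alone, so it can
  be compared between two paths.\<close>

lemma north_iff_rank: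
  assumes "k < length x"
  shows "x ! k = North \<longleftrightarrow> (\<exists>i\<in>{1..n}. rank k = i - 1 + easts_before i)"
proof
  assume "x ! k = North"
  then show "\<exists>i\<in>{1..n}. rank k = i - 1 + easts_before i"
    using north_obtain[of k] rank_label assms by blast
next
  assume "\<exists>i\<in>{1..n}. rank k = i - 1 + easts_before i"
  then obtain i where i: "i \<in> {1..n}" "rank k = i - 1 + easts_before i" by blast
  then obtain m where m: "m \<in> norths" "l i = w m" using l_obtain by blast
  then have "rank k = rank m" using i rank_label[of i m] by simp
  then have "k = m" using rank_eq_iff[of k m] m assms by auto
  then show "x ! k = North" using m by simp
qed

text \<open>Adding \<open>p\<close> preserves the order of North labels, so exactly
  \<open>i - 1\<close> North end points lie below this one.\<close>

lemma rank_Suc_north: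
  assumes "k < length x" "i \<in> {1..n}" "rank k = i - 1 + easts_before i"
  shows "rank (Suc k) = i - 1 + east_ends_before i"
proof -
  obtain m where m: "m \<in> norths" "l i = w m" using l_obtain assms by blast
  then have "rank k = rank m" using assms rank_label[of i m] by simp
  then have "k = m" using rank_eq_iff[of k m] m assms by auto
  then have "w (Suc k) = l i + int p" using m w_Suc_north by simp
  then show ?thesis
    using rank_split_ends[of "Suc k"] card_indices_less[OF assms(2)]
    by (simp add: east_ends_before_def)
qed

text \<open>\<open>r\<close> counts the East starting points below \<open>w k\<close>, equivalently
  the East end points below \<open>w (Suc k)\<close>. A North end point is below
  \<open>w (Suc k)\<close> iff at most \<open>r\<close> East end points are below it. The right-hand
  side involves only \<open>rank k\<close> and tableau data.\<close>

lemma rank_Suc_east: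
  assumes "k < length x" "x ! k = East"
  defines "r \<equiv> rank k - card {i \<in> {1..n}. i - 1 + easts_before i < rank k}"
  shows "rank (Suc k) = card {i \<in> {1..n}. east_ends_before i \<le> r} + r"
proof -
  have "i - 1 + easts_before i < rank k \<longleftrightarrow> l i < w k" if "i \<in> {1..n}" for i
  proof -
    obtain m where m: "m \<in> norths" "l i = w m" using l_obtain \<open>i \<in> {1..n}\<close> by blast
    then show ?thesis
      using rank_label[of i m] rank_less_iff[of m k] that assms by simp
  qed
  then have "{i \<in> {1..n}. i - 1 + easts_before i < rank k} = {i \<in> {1..n}. l i < w k}"
    by blast
  then have r: "r = card {m \<in> easts. w m < w k}"
    using rank_split[of k] by (simp add: r_def)
  have wS: "w (Suc k) = w k - int n" using assms w_Suc_east by simp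
  have "east_ends_before i \<le> r \<longleftrightarrow> l i + int p < w (Suc k)" if i: "i \<in> {1..n}" for i
  proof
    assume "l i + int p < w (Suc k)"
    then have "{m \<in> easts. w m - int n < l i + int p} \<subseteq> {m \<in> easts. w m < w k}"
      using wS by auto
    then show "east_ends_before i \<le> r"
      unfolding east_ends_before_def r by (intro card_mono) auto
  next
    assume le: "east_ends_before i \<le> r"
    show "l i + int p < w (Suc k)"
    proof (rule ccontr)
      assume "\<not> l i + int p < w (Suc k)"
      moreover have "l i + int p \<noteq> w (Suc k)"
      proof
        assume eq: "l i + int p = w (Suc k)"
        obtain m where m: "m \<in> norths" "l i = w m" using l_obtain i by blast
        then have eq: "w (Suc m) = w (Suc k)" using eq w_Suc_north by simp
        \<comment> \<open>Start and end of the path share label 0, and \<open>w\<close> is injective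
          only below \<open>length x\<close>; \<open>red\<close> sends the final index to 0 so that
          injectivity applies to end points.\<close>
        define red where "red q = (if q = length x then 0 else q)" for q
        have red: "w (red q) = w q" "q \<le> length x \<Longrightarrow> red q < length x" for q
          using w_0 w_length length_path n_pos by (auto simp: red_def)
        have "red (Suc m) = red (Suc k)"
          using w_eq_iff[of "red (Suc m)" "red (Suc k)"] red eq m assms by auto
        then have "m = k"
          by (auto simp: red_def split: if_splits)
        then show False using m assms by simp
      qed
      ultimately have "w k - int n < l i + int p" using wS by simp
      \<comment> \<open>The inclusion is proper because step \<open>k\<close> itself belongs only to
        the right-hand set.\<close>
      then have "{m \<in> easts. w m < w k} \<subset> {m \<in> easts. w m - int n < l i + int p}"
        using assms by auto
      then have "r < east_ends_before i"
        unfolding east_ends_before_def r by (intro psubset_card_mono) auto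
      then show False using le by simp
    qed
  qed
  then have "{i \<in> {1..n}. l i + int p < w (Suc k)} = {i \<in> {1..n}. east_ends_before i \<le> r}"
    by blast
  moreover have "{m \<in> easts. w m - int n < w (Suc k)} = {m \<in> easts. w m < w k}"
    using wS by auto
  ultimately show ?thesis
    using rank_split_ends[of "Suc k"] r by simp
qed

lemma rank_0: "rank 0 = 0"
proof -
  have "{m. m < length x \<and> w m < w 0} = {}"
    unfolding w_0 using w_nonneg by (metis (no_types, lifting) empty_Collect_eq less_imp_le not_less)
  then show ?thesis by (simp only: rank_def card.empty)
qed

end

section \<open>Reconstruction of the path from the tableau\<close>

theorem theorem3p6:
  fixes n p :: nat and x y :: "step list"
  assumes "n > 0" and "p > 0" and "coprime n p"
    and "x \<in> rational_dyck_paths n p" and "y \<in> rational_dyck_paths n p"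
    and "\<And>i j. i \<in> {1..n} \<Longrightarrow> j \<in> {1..n} \<Longrightarrow> i < j \<Longrightarrow> codinv n p x i j = codinv n p y i j"
  shows "x = y"
proof -
  interpret X: rational_dyck_path n p x using assms by unfold_locales
  interpret Y: rational_dyck_path n p y using assms by unfold_locales
  have before: "X.easts_before j = Y.easts_before j" if "j \<in> {1..n}" for j
    unfolding X.easts_before_def Y.easts_before_def
      X.column_sum[OF that, symmetric] Y.column_sum[OF that, symmetric]
    using that assms(6) by (intro sum.cong) auto
  have ends: "X.east_ends_before i = Y.east_ends_before i" if "i \<in> {1..n}" for i
  proof -
    have "(\<Sum>j\<in>{i<..n}. codinv n p x i j) = (\<Sum>j\<in>{i<..n}. codinv n p y i j)"
      using that assms(6) by (intro sum.cong) auto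
    then show ?thesis
      by (simp add: X.east_ends_before_row_sum[OF that] Y.east_ends_before_row_sum[OF that])
  qed
  have len: "length x = length y"
    by (simp add: X.length_path Y.length_path)
  have north: "x ! k = North \<longleftrightarrow> y ! k = North" if "k < length x" "X.rank k = Y.rank k" for k
    using X.north_iff_rank[of k] Y.north_iff_rank[of k] that before len by auto
  \<comment> \<open>The next rank depends only on the current rank, the step type it determines, and
    the shared counts.\<close>
  have rank: "X.rank k = Y.rank k" if "k \<le> length x" for k
    using that
  proof (induction k)
    case 0
    then show ?case by (simp add: X.rank_0 Y.rank_0)
  next
    case (Suc k)
    then have k: "k < length x" "k < length y" and IH: "X.rank k = Y.rank k"
      using len by auto
    show ?case
    proof (cases "x ! k")
      case North
      then obtain i where "i \<in> {1..n}" "X.rank k = i - 1 + X.easts_before i"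
        using X.north_iff_rank k by blast
      then show ?thesis
        using X.rank_Suc_north[of k i] Y.rank_Suc_north[of k i] k IH before ends by simp
    next
      case East
      then have "y ! k = East"
        using north[OF k(1) IH] by (cases "y ! k") auto
      \<comment> \<open>Stated for every \<open>r\<close>, since the two sets occur in
        \<open>rank_Suc_east\<close> with different thresholds.\<close>
      moreover have "{i \<in> {1..n}. i - 1 + X.easts_before i < r} = {i \<in> {1..n}. i - 1 + Y.easts_before i < r}"
        "{i \<in> {1..n}. X.east_ends_before i \<le> r} = {i \<in> {1..n}. Y.east_ends_before i \<le> r}" for r
        using before ends by auto
      ultimately show ?thesis
        using X.rank_Suc_east[OF k(1) East] Y.rank_Suc_east[OF k(2)] IH by simp
    qed
  qed
  show "x = y"
  proof (rule nth_equalityI[OF len])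
    fix k assume "k < length x"
    then show "x ! k = y ! k"
      using north[of k] rank[of k] by (cases "x ! k"; cases "y ! k") auto
  qed
qed

end
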